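(* Let $\mu\in(0,1)$. Two players $A$ and $B$ generate a sequence $s=(s_1,s_2,\dots)\in\{0,1\}^{\mathbb{N}}$, player $A$ choosing the odd-indexed bits and player $B$ the even-indexed bits, where the prescribed strategies are that the player choosing the bit in period $n$ chooses $1$ with probability $\mu/n$ and $0$ with probability $1-\mu/n$, regardless of the past. Let $D$ be the set of all sequences $s$ for which there is no $k\ge0$ with $s_{2k+1}=s_{2k+2}=1$. Define $f:D^c\to\{A,B\}$ by $f(s)=A$ if $$\sum_{k\ge0,\ s_{2k+1}=1}\frac{\mu}{2k+2}>\mu,$$ and $f(s)=B$ otherwise. Then the goal consisting of the prescribed strategy pair and $D$ is $\mu$-testable by the blame function $f$; that is: (i) if player $A$ uses the prescribed strategy and player $B$ uses an arbitrary behavior strategy, then the probability that $s\in D^c$ and $f(s)=A$ is at most $\mu$; (ii) if player $B$ uses the prescribed strategy and player $A$ uses an arbitrary behavior strategy, then the probability that $s\in D^c$ and $f(s)=B$ is at most $\mu$.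
   Context: The bits are chosen sequentially, and each player observes all previous bits. A behavior strategy of a player assigns to each finite history after which that player moves a probability distribution on $\{0,1\}$ for the next bit. $D^c=\{0,1\}^{\mathbb{N}}\setminus D$. *)

theory Defs
  imports "HOL-Probability.Probability"
begin

datatype player = A | B

(* The bit 1 is True and the bit 0 is False.  The infinite sequence (s_1, s_2, ...) is a
   function s :: nat => bool with s_n = s (n - 1).  A finite history lists the bits in the
   order in which they were chosen, so the bit chosen after h is the one of period length h + 1. *)

definition mover :: "bool list \<Rightarrow> player" where
  "mover h = (if odd (length h + 1) then A else B)"

(* A behavior strategy is total on histories for convenience; a player's strategy is only ever
   consulted at the histories after which that player moves (see next_bit). *)

type_synonym strategy = "bool list \<Rightarrow> bool pmf"

definition next_bit :: "strategy \<Rightarrow> strategy \<Rightarrow> bool list \<Rightarrow> bool pmf" where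
  "next_bit \<sigma>A \<sigma>B h = (case mover h of A \<Rightarrow> \<sigma>A h | B \<Rightarrow> \<sigma>B h)"

definition history :: "nat \<Rightarrow> (nat \<Rightarrow> bool) \<Rightarrow> bool list" where
  "history n s = map s [0..<n]"

lemma history_restrict: "history n (restrict s {0..<n}) = history n s"
  by (simp add: history_def)

lemma history_fun_upd [simp]: "history n (s(n := b)) = history n s"
  by (simp add: history_def)

lemma length_history [simp]: "length (history n s) = n"
  by (simp add: history_def)

abbreviation bit_space :: "nat \<Rightarrow> bool measure" where
  "bit_space \<equiv> \<lambda>_. count_space UNIV"

lemma PiM_bits_finite:
  "finite J \<Longrightarrow> PiM J bit_space = count_space (PiE J (\<lambda>_. UNIV))"
  by (rule count_space_PiM_finite) auto

lemma Ionescu_Tulcea_bits: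
  fixes p :: "bool list \<Rightarrow> bool pmf"
  shows "Ionescu_Tulcea (\<lambda>n s. measure_pmf (p (history n s))) bit_space"
proof
  show "(\<lambda>s. measure_pmf (p (history n s)))
      \<in> measurable (PiM {0..<n} bit_space) (subprob_algebra (count_space UNIV))" for n
    by (subst PiM_bits_finite)
       (auto simp: space_subprob_algebra intro: prob_space_imp_subprob_space prob_space_measure_pmf)
qed

(* By the Ionescu-Tulcea theorem, one-step kernels p extend to a law on infinite sequences,
   with the product sigma-algebra; emeasure_law_cylinder below characterizes it. *)

definition law :: "(bool list \<Rightarrow> bool pmf) \<Rightarrow> (nat \<Rightarrow> bool) measure" where
  "law p = projective_family.lim UNIV
     (Ionescu_Tulcea.CI (\<lambda>n s. measure_pmf (p (history n s))) bit_space) bit_space"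

lemma sets_law: "sets (law p) = sets (PiM UNIV bit_space)"
proof -
  interpret Ionescu_Tulcea "\<lambda>n s. measure_pmf (p (history n s))" bit_space
    by (rule Ionescu_Tulcea_bits)
  show ?thesis unfolding law_def by (rule PF.sets_lim)
qed

lemma space_law [simp]: "space (law p) = UNIV"
  using sets_eq_imp_space_eq[OF sets_law] by (simp add: space_PiM)

lemma prob_space_law: "prob_space (law p)"
proof -
  interpret Ionescu_Tulcea "\<lambda>n s. measure_pmf (p (history n s))" bit_space
    by (rule Ionescu_Tulcea_bits)
  interpret CE: prob_space "CI {}" by (rule PF.prob_space_P) auto
  have "emeasure PF.lim (PF.emb UNIV {} {\<lambda>_. undefined}) = emeasure (CI {}) {\<lambda>_. undefined}"
    by (rule lim) (auto simp: PiM_empty)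
  moreover have "space (CI {}) = {\<lambda>_. undefined}"
    by (simp add: CI_def space_PiM)
  moreover have "PF.emb UNIV {} {\<lambda>_. undefined} = UNIV"
    by (auto simp: prod_emb_def space_PiM)
  ultimately show ?thesis
    using CE.emeasure_space_1 by (intro prob_spaceI) (simp add: law_def[symmetric])
qed

lemma emeasure_law_cylinder:
  "emeasure (law p) {s. history (length w) s = w} = (\<Prod>i<length w. ennreal (pmf (p (take i w)) (w ! i)))"
proof -
  interpret Ionescu_Tulcea "\<lambda>n s. measure_pmf (p (history n s))" bit_space
    by (rule Ionescu_Tulcea_bits)
  define cyl where "cyl w = {s \<in> PiE {0..<length w} (\<lambda>_. UNIV). history (length w) s = w}"
    for w :: "bool list"
  have sets_cyl: "cyl w \<in> sets (PiM {0..<length w} bit_space)" for w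
    by (auto simp: PiM_bits_finite cyl_def)
  have *: "emeasure (C 0 (length w) (\<lambda>_. undefined)) (cyl w)
      = (\<Prod>i<length w. ennreal (pmf (p (take i w)) (w ! i)))" for w
  proof (induction w rule: rev_induct)
    case Nil
    have "cyl [] = {\<lambda>_. undefined}" by (auto simp: cyl_def history_def)
    then show ?case by (simp add: PiM_empty)
  next
    case (snoc b w)
    let ?n = "length w"
    let ?C = "C 0 ?n (\<lambda>_. undefined)"
    have u: "(\<lambda>_. undefined) \<in> space (PiM {0..<0} bit_space)"
      by (simp add: space_PiM)
    note sp = space_C[OF u, of ?n, simplified] and se = sets_C[OF u, of ?n, simplified]
    have sc: "cyl (w @ [b]) \<in> sets (PiM {0..<Suc ?n} bit_space)"
      using sets_cyl[of "w @ [b]"] by simp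
    have "emeasure (C 0 (Suc ?n) (\<lambda>_. undefined)) (cyl (w @ [b]))
        = (\<integral>\<^sup>+s. emeasure (eP ?n s) (cyl (w @ [b])) \<partial>?C)"
      unfolding C.simps
      by (subst emeasure_bind[OF _ _ sc])
         (use prob_space.not_empty[OF prob_space_C[OF u]] measurable_eP[of ?n] in
           \<open>auto simp: measurable_cong_sets[OF se refl]\<close>)
    also have "\<dots> = (\<integral>\<^sup>+s. ennreal (pmf (p w) b) * indicator (cyl w) s \<partial>?C)"
    proof (rule nn_integral_cong)
      fix s assume "s \<in> space ?C"
      then have s: "s \<in> space (PiM {0..<?n} bit_space)" by (simp add: sp)
      then have sE: "s \<in> PiE {0..<?n} (\<lambda>_. UNIV)" by (simp add: space_PiM)
      have "history (Suc ?n) (s(?n := x)) = history ?n s @ [x]" for x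
        by (simp add: history_def)
      then have "(\<lambda>x. s(?n := x)) -` cyl (w @ [b]) = (if s \<in> cyl w then {b} else {})"
        using sE by (auto simp: cyl_def PiE_def extensional_def)
      then show "emeasure (eP ?n s) (cyl (w @ [b])) = ennreal (pmf (p w) b) * indicator (cyl w) s"
        using emeasure_eP[OF s sc] by (auto simp: emeasure_pmf_single cyl_def)
    qed
    also have "\<dots> = ennreal (pmf (p w) b) * emeasure ?C (cyl w)"
      using sets_cyl[of w] se by (simp add: nn_integral_cmult_indicator)
    also have "\<dots> = (\<Prod>i<Suc ?n. ennreal (pmf (p (take i (w @ [b]))) ((w @ [b]) ! i)))"
      by (simp add: snoc.IH nth_append mult.commute)
    finally show ?case by simp
  qed
  have "{s. history (length w) s = w} = PF.emb UNIV {0..<length w} (cyl w)"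
    by (auto simp: prod_emb_def space_PiM cyl_def history_restrict)
  moreover have "emeasure PF.lim (PF.emb UNIV {0..<length w} (cyl w)) = emeasure (CI {0..<length w}) (cyl w)"
    using sets_cyl by (intro lim) auto
  moreover have "emeasure (CI {0..<length w}) (cyl w)
      = emeasure (C 0 (length w) (\<lambda>_. undefined)) (PF.emb {0..<length w} {0..<length w} (cyl w))"
    using sets_cyl by (intro emeasure_CI) auto
  moreover have "PF.emb {0..<length w} {0..<length w} (cyl w) = cyl w"
    by (rule prod_emb_id) (auto simp: cyl_def)
  ultimately show ?thesis
    using *[of w] by (simp add: law_def)
qed

definition play :: "strategy \<Rightarrow> strategy \<Rightarrow> (nat \<Rightarrow> bool) measure" where
  "play \<sigma>A \<sigma>B = law (next_bit \<sigma>A \<sigma>B)"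

definition prescribed :: "real \<Rightarrow> strategy" where
  "prescribed \<mu> h = bernoulli_pmf (\<mu> / real (length h + 1))"

definition D :: "(nat \<Rightarrow> bool) set" where
  "D = {s. \<not> (\<exists>k. s (2 * k) \<and> s (2 * k + 1))}"

(* The sum may diverge, hence it is taken in the extended nonnegative reals.  Only the values
   outside D matter. *)

definition blame :: "real \<Rightarrow> (nat \<Rightarrow> bool) \<Rightarrow> player" where
  "blame \<mu> s =
     (if (\<Sum>k. if s (2 * k) then ennreal (\<mu> / real (2 * k + 2)) else 0) > ennreal \<mu>
      then A else B)"

definition testable_by ::
    "real \<Rightarrow> strategy \<times> strategy \<Rightarrow> (nat \<Rightarrow> bool) set \<Rightarrow> ((nat \<Rightarrow> bool) \<Rightarrow> player) \<Rightarrow> bool" where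
  "testable_by \<delta> \<sigma> G f \<longleftrightarrow>
     (\<forall>\<tau>. measure (play (fst \<sigma>) \<tau>) {s. s \<in> - G \<and> f s = A} \<le> \<delta>) \<and>
     (\<forall>\<tau>. measure (play \<tau> (snd \<sigma>)) {s. s \<in> - G \<and> f s = B} \<le> \<delta>)"

lemma sets_blamed: "{s. s \<in> - D \<and> blame \<mu> s = i} \<in> sets (play \<sigma>A \<sigma>B)"
proof -
  have [measurable]: "(\<lambda>s. s n) \<in> measurable (play \<sigma>A \<sigma>B) (count_space UNIV)" for n
    unfolding play_def measurable_cong_sets[OF sets_law refl]
    using measurable_component_singleton[of n UNIV bit_space] by simp
  have [measurable]: "Measurable.pred (play \<sigma>A \<sigma>B) (\<lambda>s. s \<in> D)"
    unfolding D_def by simp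
  have [measurable]: "blame \<mu> \<in> measurable (play \<sigma>A \<sigma>B) (count_space UNIV)"
    unfolding blame_def[abs_def] by measurable
  have "{s \<in> space (play \<sigma>A \<sigma>B). s \<notin> D \<and> blame \<mu> s = i} \<in> sets (play \<sigma>A \<sigma>B)"
    by measurable
  then show ?thesis by (simp add: play_def)
qed

end

theory Submission
  imports Defs
begin

text \<open>
  Suppose every 1 chosen by player \<open>A\<close> in period \<open>2k + 1\<close> puts the amount \<open>\<mu> / (2k + 2)\<close> on a
  running bill. This amount is exactly the prescribed conditional probability that player \<open>B\<close>
  answers with a 1, that is, the risk of leaving \<open>D\<close> which that move of \<open>A\<close> creates. The blame
  function accuses \<open>A\<close> if and only if the total bill exceeds \<open>\<mu>\<close>, and each half of the theorem
  is a first-moment estimate for the bill.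

  If \<open>A\<close> follows the prescription, the expected bill is the sum of \<open>\<mu>\<^sup>2 / ((2k + 1) (2k + 2))\<close>,
  which is at most \<open>\<mu>\<^sup>2\<close>, so by Markov's inequality the bill exceeds \<open>\<mu>\<close> with probability
  at most \<open>\<mu>\<close>, whether or not \<open>D\<close> is left.

  If \<open>B\<close> follows the prescription and \<open>B\<close> is blamed, some coincidence \<open>s\<^sub>2\<^sub>k\<^sub>+\<^sub>1 = s\<^sub>2\<^sub>k\<^sub>+\<^sub>2 = 1\<close>
  occurs while the bill, including the charge of period \<open>2k + 1\<close>, is still at most \<open>\<mu>\<close>.
  Whether it is still so low is known before \<open>B\<close> moves, so the probability of such a coincidence
  is the expectation of the charge made in period \<open>2k + 1\<close>, counted only while the bill stays
  within \<open>\<mu>\<close>. Along every play the charges counted in this way add up to at most \<open>\<mu>\<close>,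
  and the union bound finishes the proof, whatever \<open>A\<close> does.
\<close>

section \<open>One step of the law of a play\<close>

lemma history_eq_iff: "history n s = history n t \<longleftrightarrow> (\<forall>i<n. s i = t i)"
  by (auto simp: history_def)

lemma history_Suc: "history (Suc n) s = history n s @ [s n]"
  by (simp add: history_def)

lemma measurable_coordinate [measurable]:
  "(\<lambda>s. s n) \<in> measurable (law p) (count_space UNIV)"
  unfolding measurable_cong_sets[OF sets_law refl]
  using measurable_component_singleton[of n UNIV bit_space] by simp

lemma sets_cylinder: "{s. history n s = w} \<in> sets (law p)"
proof -
  have "{s. history n s = w} = {s \<in> space (law p). length w = n \<and> (\<forall>i<n. s i = w ! i)}"
    by (auto simp: history_def list_eq_iff_nth_eq)
  also have "\<dots> \<in> sets (law p)" by measurable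
  finally show ?thesis .
qed

lemma emeasure_law_cylinder_snoc:
  "emeasure (law p) {s. history (Suc (length w)) s = w @ [b]} =
     ennreal (pmf (p w) b) * emeasure (law p) {s. history (length w) s = w}"
  using emeasure_law_cylinder[of p "w @ [b]"] emeasure_law_cylinder[of p w]
  by (simp add: nth_append mult.commute)

text \<open>
  This is the Markov-type property of the law in the only form needed: when the next bit has the
  same conditional distribution after all histories compatible with an event from the past, the
  probability of the bit factors out. The event is a finite disjoint union of cylinders, and the
  kernel is constant on them.
\<close>

lemma emeasure_law_next_bit:
  assumes past: "\<And>s t. (\<And>i. i < n \<Longrightarrow> s i = t i) \<Longrightarrow> s \<in> E \<Longrightarrow> t \<in> E"
    and c: "\<And>w. length w = n \<Longrightarrow> pmf (p w) b = c"
  shows "emeasure (law p) {s \<in> E. s n = b} = ennreal c * emeasure (law p) E"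
proof -
  let ?W = "history n ` E"
  have "?W \<subseteq> {w. set w \<subseteq> UNIV \<and> length w = n}" by auto
  then have fin: "finite ?W"
    by (rule finite_subset) (rule finite_lists_length_eq, simp)
  have E: "E = (\<Union>w\<in>?W. {s. history n s = w})"
  proof (intro equalityI subsetI)
    fix t assume "t \<in> (\<Union>w\<in>?W. {s. history n s = w})"
    then obtain s where "s \<in> E" "history n s = history n t" by auto
    then show "t \<in> E" using past by (auto simp: history_eq_iff)
  qed auto
  have Eb: "{s \<in> E. s n = b} = (\<Union>w\<in>?W. {s. history (Suc n) s = w @ [b]})"
    by (subst (1) E) (auto simp: history_Suc)
  have "emeasure (law p) {s \<in> E. s n = b} =
      (\<Sum>w\<in>?W. emeasure (law p) {s. history (Suc n) s = w @ [b]})"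
    unfolding Eb using fin
    by (intro sum_emeasure[symmetric]) (auto simp: sets_cylinder disjoint_family_on_def)
  also have "\<dots> = (\<Sum>w\<in>?W. ennreal c * emeasure (law p) {s. history n s = w})"
  proof (rule sum.cong)
    fix w assume "w \<in> ?W"
    then have "length w = n" by auto
    then show "emeasure (law p) {s. history (Suc n) s = w @ [b]} =
        ennreal c * emeasure (law p) {s. history n s = w}"
      using emeasure_law_cylinder_snoc[of p w b] c[of w] by simp
  qed simp
  also have "\<dots> = ennreal c * (\<Sum>w\<in>?W. emeasure (law p) {s. history n s = w})"
    by (simp add: sum_distrib_left)
  also have "(\<Sum>w\<in>?W. emeasure (law p) {s. history n s = w}) =
      emeasure (law p) (\<Union>w\<in>?W. {s. history n s = w})"
    using fin by (intro sum_emeasure) (auto simp: sets_cylinder disjoint_family_on_def)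
  finally show ?thesis using E by simp
qed

lemma pmf_prescribed:
  assumes "0 < \<mu>" "\<mu> < 1"
  shows "pmf (prescribed \<mu> h) True = \<mu> / real (length h + 1)"
  unfolding prescribed_def using assms by (intro pmf_bernoulli_True) (auto simp: field_simps)

section \<open>The bill of player A\<close>

definition charge :: "real \<Rightarrow> (nat \<Rightarrow> bool) \<Rightarrow> nat \<Rightarrow> ennreal" where
  "charge \<mu> s k = (if s (2 * k) then ennreal (\<mu> / real (2 * k + 2)) else 0)"

lemma measurable_charge [measurable]: "(\<lambda>s. charge \<mu> s k) \<in> borel_measurable (law p)"
  unfolding charge_def by measurable

lemma blame_eq_A_iff: "blame \<mu> s = A \<longleftrightarrow> ennreal \<mu> < (\<Sum>k. charge \<mu> s k)"
  by (simp add: blame_def charge_def)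

text \<open>
  A capped bill never exceeds its cap: the last term that is counted belongs to a partial sum that
  is within the cap and dominates all the terms counted so far.
\<close>

lemma suminf_capped_le:
  fixes a :: "nat \<Rightarrow> ennreal"
  shows "(\<Sum>k. if (\<Sum>i\<le>k. a i) \<le> c then a k else 0) \<le> c"
proof (rule suminf_le_const)
  show "(\<Sum>k<n. if (\<Sum>i\<le>k. a i) \<le> c then a k else 0) \<le> c" for n
  proof (induction n)
    case (Suc n)
    show ?case
    proof (cases "(\<Sum>i\<le>n. a i) \<le> c")
      case True
      have "(\<Sum>k<Suc n. if (\<Sum>i\<le>k. a i) \<le> c then a k else 0) \<le> (\<Sum>k<Suc n. a k)"
        by (intro sum_mono) auto
      also have "\<dots> = (\<Sum>i\<le>n. a i)" by (simp only: lessThan_Suc_atMost)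
      finally show ?thesis using True by (rule order_trans)
    qed (use Suc in simp)
  qed simp
qed simp

text \<open>
  The exact value of this series is \<open>ln 2\<close>; comparison with the telescoping series of
  \<open>1 / ((k + 1) (k + 2))\<close> already gives the bound 1, which is all that Markov's inequality needs.
\<close>

lemma suminf_inverse_consecutive_le_1:
  "(\<Sum>k. ennreal (1 / (real (2 * k + 1) * real (2 * k + 2)))) \<le> 1"
proof (rule suminf_le_const)
  fix n
  have "(\<Sum>k<n. 1 / (real (2 * k + 1) * real (2 * k + 2))) \<le> 1 - 1 / (real n + 1)"
  proof (induction n)
    case (Suc n)
    have "(real n + 1) * (real n + 2) \<le> real (2 * n + 1) * real (2 * n + 2)"
      by (simp add: algebra_simps)
    then have "1 / (real (2 * n + 1) * real (2 * n + 2)) \<le> 1 / ((real n + 1) * (real n + 2))"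
      by (intro divide_left_mono) auto
    also have "\<dots> = 1 / (real n + 1) - 1 / (real n + 2)"
      by (simp add: field_simps)
    finally show ?case using Suc by (simp add: add.commute)
  qed simp
  also have "\<dots> \<le> 1" by simp
  finally show "(\<Sum>k<n. ennreal (1 / (real (2 * k + 1) * real (2 * k + 2)))) \<le> 1"
    by (subst sum_ennreal) auto
qed simp

section \<open>The two error probabilities\<close>

text \<open>
  Linearity of expectation gives the expected bill without any independence: \<open>B\<close> may react to
  the past, but each single bit of \<open>A\<close> keeps its prescribed distribution.
\<close>

lemma emeasure_blame_A_le:
  assumes \<mu>: "0 < \<mu>" "\<mu> < 1"
  shows "emeasure (play (prescribed \<mu>) \<tau>) {s. s \<in> - D \<and> blame \<mu> s = A} \<le> ennreal \<mu>"
proof -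
  let ?p = "next_bit (prescribed \<mu>) \<tau>"
  let ?M = "law ?p"
  interpret prob_space ?M by (rule prob_space_law)
  have one: "emeasure ?M {s. s (2 * k)} = ennreal (\<mu> / real (2 * k + 1))" for k
  proof -
    have "emeasure ?M {s \<in> UNIV. s (2 * k) = True} =
        ennreal (\<mu> / real (2 * k + 1)) * emeasure ?M UNIV"
      by (rule emeasure_law_next_bit)
         (auto simp: next_bit_def mover_def pmf_prescribed[OF \<mu>])
    then show ?thesis using emeasure_space_1 by simp
  qed
  have "(\<integral>\<^sup>+s. (\<Sum>k. charge \<mu> s k) \<partial>?M) = (\<Sum>k. \<integral>\<^sup>+s. charge \<mu> s k \<partial>?M)"
    by (rule nn_integral_suminf) measurable
  also have "\<dots> = (\<Sum>k. ennreal (\<mu>\<^sup>2) * ennreal (1 / (real (2 * k + 1) * real (2 * k + 2))))"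
  proof (rule suminf_cong)
    fix k
    have "{s \<in> space ?M. s (2 * k)} \<in> sets ?M" by measurable
    then have "(\<integral>\<^sup>+s. ennreal (\<mu> / real (2 * k + 2)) * indicator {s. s (2 * k)} s \<partial>?M) =
        ennreal (\<mu> / real (2 * k + 2)) * ennreal (\<mu> / real (2 * k + 1))"
      by (simp add: nn_integral_cmult_indicator one)
    moreover have "(\<lambda>s. charge \<mu> s k) =
        (\<lambda>s. ennreal (\<mu> / real (2 * k + 2)) * indicator {s. s (2 * k)} s)"
      by (auto simp: charge_def indicator_def)
    ultimately show "(\<integral>\<^sup>+s. charge \<mu> s k \<partial>?M) =
        ennreal (\<mu>\<^sup>2) * ennreal (1 / (real (2 * k + 1) * real (2 * k + 2)))"
      using \<mu> by (simp add: ennreal_mult[symmetric] power2_eq_square mult.commute)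
  qed
  also have "\<dots> \<le> ennreal (\<mu>\<^sup>2) * 1"
    unfolding ennreal_suminf_cmult
    by (intro mult_left_mono suminf_inverse_consecutive_le_1) simp
  finally have bill: "(\<integral>\<^sup>+s. (\<Sum>k. charge \<mu> s k) \<partial>?M) \<le> ennreal (\<mu>\<^sup>2)" by simp
  have "emeasure ?M {s. s \<in> - D \<and> blame \<mu> s = A} \<le>
      emeasure ?M {s \<in> space ?M. 1 \<le> ennreal (1 / \<mu>) * (\<Sum>k. charge \<mu> s k)}"
  proof (rule emeasure_mono)
    show "{s. s \<in> - D \<and> blame \<mu> s = A} \<subseteq>
        {s \<in> space ?M. 1 \<le> ennreal (1 / \<mu>) * (\<Sum>k. charge \<mu> s k)}"
    proof (clarsimp simp: blame_eq_A_iff)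
      fix s assume "ennreal \<mu> < (\<Sum>k. charge \<mu> s k)"
      then have "ennreal (1 / \<mu>) * ennreal \<mu> \<le> ennreal (1 / \<mu>) * (\<Sum>k. charge \<mu> s k)"
        by (intro mult_left_mono) auto
      then show "1 \<le> ennreal (1 / \<mu>) * (\<Sum>k. charge \<mu> s k)"
        using \<mu> by (simp add: ennreal_mult[symmetric])
    qed
  qed measurable
  also have "\<dots> \<le> ennreal (1 / \<mu>) * (\<integral>\<^sup>+s. (\<Sum>k. charge \<mu> s k) * indicator (space ?M) s \<partial>?M)"
    by (rule nn_integral_Markov_inequality) measurable
  also have "\<dots> \<le> ennreal (1 / \<mu>) * ennreal (\<mu>\<^sup>2)"
    using bill by (intro mult_left_mono) simp_all
  also have "\<dots> = ennreal \<mu>"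
    using \<mu> by (simp add: ennreal_mult[symmetric] power2_eq_square)
  finally show ?thesis unfolding play_def .
qed

text \<open>
  Stopping the count when the bill passes \<open>\<mu>\<close> is what makes the union bound affordable: over the
  whole play the charges may add up to infinity, but the capped ones cannot exceed \<open>\<mu>\<close>.
\<close>

lemma emeasure_blame_B_le:
  assumes \<mu>: "0 < \<mu>" "\<mu> < 1"
  shows "emeasure (play \<tau> (prescribed \<mu>)) {s. s \<in> - D \<and> blame \<mu> s = B} \<le> ennreal \<mu>"
proof -
  let ?p = "next_bit \<tau> (prescribed \<mu>)"
  let ?M = "law ?p"
  let ?E = "\<lambda>k. {s. s (2 * k) \<and> (\<Sum>i\<le>k. charge \<mu> s i) \<le> ennreal \<mu>}"
  interpret prob_space ?M by (rule prob_space_law)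
  have E: "?E k \<in> sets ?M" for k
  proof -
    have "{s \<in> space ?M. s (2 * k) \<and> (\<Sum>i\<le>k. charge \<mu> s i) \<le> ennreal \<mu>} \<in> sets ?M"
      by measurable
    then show ?thesis by simp
  qed
  have E': "{s \<in> ?E k. s (2 * k + 1) = True} \<in> sets ?M" for k
  proof -
    have "{s \<in> space ?M. s \<in> ?E k \<and> s (2 * k + 1)} \<in> sets ?M"
      using E[of k] by measurable
    then show ?thesis by simp
  qed
  \<comment> \<open>The event is decided before \<open>B\<close> moves, so the risk it creates equals the expected charge.\<close>
  have next_bit: "emeasure ?M {s \<in> ?E k. s (2 * k + 1) = True} =
      ennreal (\<mu> / real (2 * k + 2)) * emeasure ?M (?E k)" for k
  proof (rule emeasure_law_next_bit)
    fix s t :: "nat \<Rightarrow> bool"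
    assume eq: "\<And>i. i < 2 * k + 1 \<Longrightarrow> s i = t i" and s: "s \<in> ?E k"
    have "(\<Sum>i\<le>k. charge \<mu> t i) = (\<Sum>i\<le>k. charge \<mu> s i)"
      using eq by (intro sum.cong) (auto simp: charge_def)
    then show "t \<in> ?E k" using s eq[of "2 * k"] by simp
  qed (auto simp: next_bit_def mover_def pmf_prescribed[OF \<mu>])
  have "emeasure ?M {s. s \<in> - D \<and> blame \<mu> s = B} \<le>
      emeasure ?M (\<Union>k. {s \<in> ?E k. s (2 * k + 1) = True})"
  proof (rule emeasure_mono)
    show "{s. s \<in> - D \<and> blame \<mu> s = B} \<subseteq> (\<Union>k. {s \<in> ?E k. s (2 * k + 1) = True})"
    proof
      fix s assume "s \<in> {s. s \<in> - D \<and> blame \<mu> s = B}"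
      then obtain k where k: "s (2 * k)" "s (2 * k + 1)" and "blame \<mu> s \<noteq> A"
        by (auto simp: D_def)
      then have "(\<Sum>i. charge \<mu> s i) \<le> ennreal \<mu>"
        by (simp add: blame_eq_A_iff not_less)
      moreover have "(\<Sum>i\<le>k. charge \<mu> s i) \<le> (\<Sum>i. charge \<mu> s i)"
        by (rule sum_le_suminf) auto
      ultimately show "s \<in> (\<Union>k. {s \<in> ?E k. s (2 * k + 1) = True})"
        using k by (auto intro: order_trans)
    qed
  qed (use E' in auto)
  also have "\<dots> \<le> (\<Sum>k. emeasure ?M {s \<in> ?E k. s (2 * k + 1) = True})"
    using E' by (intro emeasure_subadditive_countably) auto
  also have "\<dots> = (\<Sum>k. \<integral>\<^sup>+s. ennreal (\<mu> / real (2 * k + 2)) * indicator (?E k) s \<partial>?M)"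
    using next_bit E by (simp add: nn_integral_cmult_indicator)
  also have "\<dots> = (\<integral>\<^sup>+s. (\<Sum>k. ennreal (\<mu> / real (2 * k + 2)) * indicator (?E k) s) \<partial>?M)"
    using E by (intro nn_integral_suminf[symmetric]) measurable
  also have "\<dots> \<le> (\<integral>\<^sup>+s. ennreal \<mu> \<partial>?M)"
  proof (rule nn_integral_mono)
    fix s
    have "(\<Sum>k. ennreal (\<mu> / real (2 * k + 2)) * indicator (?E k) s) =
        (\<Sum>k. if (\<Sum>i\<le>k. charge \<mu> s i) \<le> ennreal \<mu> then charge \<mu> s k else 0)"
      by (intro suminf_cong) (auto simp: charge_def indicator_def)
    also have "\<dots> \<le> ennreal \<mu>" by (rule suminf_capped_le)
    finally show "(\<Sum>k. ennreal (\<mu> / real (2 * k + 2)) * indicator (?E k) s) \<le> ennreal \<mu>" .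
  qed
  also have "\<dots> = ennreal \<mu>" using emeasure_space_1 by simp
  finally show ?thesis unfolding play_def .
qed

theorem mainTheorem4:
  fixes \<mu> :: real
  assumes "0 < \<mu>" and "\<mu> < 1"
  shows "testable_by \<mu> (prescribed \<mu>, prescribed \<mu>) D (blame \<mu>)"
  unfolding testable_by_def measure_def
  using assms emeasure_blame_A_le[OF assms] emeasure_blame_B_le[OF assms]
  by (auto intro!: enn2real_leI)

end
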